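(* Let the functions $f_i$, $g_i$ satisfy, for every $i\in\mathcal N=\{1,\dots,N\}$: (i) $f_i(\cdot,x_{-i})$ is convex in $x_i$ for every $x_{-i}\in X_{-i}$; (ii) $g_i(x_i,x_{-i},\xi_i)=\xi_i^\top Q_i\xi_i+P_i(x)^\top\xi_i$; (iii) $P_i(x)=A_ix+b_i$ with $A_i\in\mathbb R^{m\times nN}$, $b_i\in\mathbb R^m$; (iv) $Q_i=L_i^\top D_iL_i$ with $L_i$ orthogonal and $D_i$ diagonal positive semidefinite with diagonal entries sorted in decreasing order. Then the game $G$ admits the reformulation $$G_R:\ \forall i\in\mathcal N:\quad \min_{x_i\in X_i,\ \lambda_i>\lambda_{\max}(Q_i)}\ \Big\{f_i(x_i,x_{-i})+\lambda_i\Big(\varepsilon_i^2-\frac1{K_i}\sum_{k_i=1}^{K_i}(\xi_i^{(k_i)})^\top\xi_i^{(k_i)}\Big)+\frac1{4K_i}\sum_{k_i=1}^{K_i}\tilde W^{(k_i)}(x_i,x_{-i},\lambda_i)^\top\tilde Q_i(\lambda_i)\tilde W^{(k_i)}(x_i,x_{-i},\lambda_i)\Big\},$$ where $\tilde Q_i(\lambda_i)=\mathrm{diag}\big(\tfrac1{\lambda_i-\lambda_{\max}(D_i)},\dots,\tfrac1{\lambda_i-\lambda_{\min}(D_i)}\big)=(\lambda_iI_m-D_i)^{-1}$, $\tilde W^{(k_i)}(x_i,x_{-i},\lambda_i)=\tilde P_i(x_i,x_{-i})+2\lambda_i\tilde\xi_i^{(k_i)}$, $\tilde P_i(x_i,x_{-i})=L_iP_i(x_i,x_{-i})$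 and $\tilde\xi_i^{(k_i)}=L_i\xi_i^{(k_i)}$. That is: for each $i\in\mathcal N$ and each $x_{-i}\in X_{-i}$, agent $i$'s problem in $G$ and agent $i$'s problem in $G_R$ have the same optimal value; and if $(x^\ast,\lambda^\ast)$ is a Nash equilibrium of $G_R$, then $x^\ast$ is a distributionally robust Nash equilibrium of $G$.
   Context: Each agent $i\in\mathcal N=\{1,\dots,N\}$ has a decision $x_i\in X_i\subseteq\mathbb R^n$; $x_{-i}\in X_{-i}=\prod_{j\ne i}X_j$ collects the others' decisions and $x=(x_1,\dots,x_N)\in\mathbb R^{nN}$ (also written $(x_i,x_{-i})$). $f_i:\mathbb R^n\times\mathbb R^{n(N-1)}\to\mathbb R$ and $g_i:\mathbb R^n\times\mathbb R^{n(N-1)}\times\mathbb R^m\to\mathbb R$. $\|\cdot\|$ is the Euclidean norm; $\lambda_{\max}(\cdot),\lambda_{\min}(\cdot)$ denote largest and smallest eigenvalues. For each $i$, a radius $\varepsilon_i\ge0$ and samples $\xi_i^{(1)},\dots,\xi_i^{(K_i)}\in\mathbb R^m$ are fixed. The empirical distribution is $\hat{\mathbb P}_{K_i}=\frac1{K_i}\sum_{k_i=1}^{K_i}\delta_{\xi_i^{(k_i)}}$, and $\mathcal P_i=\{\mathbb Q_i \text{ probability measure on }\mathbb R^m: d_W(\mathbb Q_i,\hat{\mathbb P}_{K_i})\le\varepsilon_i\}$, where $d_W$ is the 2-Wasserstein metric $d_W(\mathbb Q_1,\mathbb Q_2)=\big(\inf_\Pi\int\|\xi_1-\xi_2\|^2\,\Pi(d\xi_1,d\xi_2)\big)^{1/2}$,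 the infimum being over couplings $\Pi$ of $\mathbb Q_1,\mathbb Q_2$. Game $G$: each agent $i$ solves $\min_{x_i\in X_i}\max_{\mathbb Q_i\in\mathcal P_i}\{f_i(x_i,x_{-i})+\mathbb E_{\xi_i\sim\mathbb Q_i}[g_i(x_i,x_{-i},\xi_i)]\}$. A point $x^\ast\in\prod_iX_i$ is a distributionally robust Nash equilibrium of $G$ if for all $i\in\mathcal N$, $x_i^\ast\in\arg\min_{x_i\in X_i}\max_{\mathbb Q_i\in\mathcal P_i}\{f_i(x_i,x^\ast_{-i})+\mathbb E_{\xi_i\sim\mathbb Q_i}[g_i(x_i,x^\ast_{-i},\xi_i)]\}$. A point $(x^\ast,\lambda^\ast)$ with $x_i^\ast\in X_i$, $\lambda_i^\ast>\lambda_{\max}(Q_i)$ is a Nash equilibrium of $G_R$ if, for every $i$, $(x_i^\ast,\lambda_i^\ast)$ minimizes agent $i$'s objective in $G_R$ over $X_i\times(\lambda_{\max}(Q_i),\infty)$ given $x_{-i}=x_{-i}^\ast$. In optimal values, $\min$ and $\max$ are read as infimum and supremum (in the extended reals). *)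

theory Defs
  imports "HOL-Probability.Probability"
begin

section \<open>Matrices\<close>

definition eigenvals :: "real^'m^'m \<Rightarrow> real set" where
  "eigenvals M = {c. \<exists>v. v \<noteq> 0 \<and> M *v v = c *\<^sub>R v}"

definition lambda_max :: "real^'m^'m \<Rightarrow> real" where
  "lambda_max M = Max (eigenvals M)"

definition lambda_min :: "real^'m^'m \<Rightarrow> real" where
  "lambda_min M = Min (eigenvals M)"

definition is_diagonal :: "real^'m^'m \<Rightarrow> bool" where
  "is_diagonal M \<longleftrightarrow> (\<forall>j k. j \<noteq> k \<longrightarrow> M $ j $ k = 0)"

definition positive_semidefinite :: "real^'m^'m \<Rightarrow> bool" where
  "positive_semidefinite M \<longleftrightarrow> transpose M = M \<and> (\<forall>v. 0 \<le> v \<bullet> (M *v v))"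

text \<open>Any finite linear order may serve as the index type, for instance the numeral types.\<close>

definition decreasing_diagonal :: "real^('m::{finite,linorder})^('m::{finite,linorder}) \<Rightarrow> bool" where
  "decreasing_diagonal M \<longleftrightarrow> (\<forall>j k. j \<le> k \<longrightarrow> M $ k $ k \<le> M $ j $ j)"

section \<open>The 2-Wasserstein ball around the empirical distribution\<close>

definition empirical :: "nat \<Rightarrow> (nat \<Rightarrow> real^'m) \<Rightarrow> (real^'m) measure" where
  "empirical K \<xi> = distr (uniform_count_measure {1..K}) borel \<xi>"

definition couplings ::
    "(real^'m) measure \<Rightarrow> (real^'m) measure \<Rightarrow> ((real^'m) \<times> (real^'m)) measure set" where
  "couplings Q1 Q2 = {Pi. sets Pi = sets (borel \<Otimes>\<^sub>M borel) \<and> prob_space Pi \<and>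
     distr Pi borel fst = Q1 \<and> distr Pi borel snd = Q2}"

definition ennreal_sqrt :: "ennreal \<Rightarrow> ennreal" where
  "ennreal_sqrt c = (if c = top then top else ennreal (sqrt (enn2real c)))"

definition wasserstein2 :: "(real^'m) measure \<Rightarrow> (real^'m) measure \<Rightarrow> ennreal" where
  "wasserstein2 Q1 Q2 = ennreal_sqrt
     (INF Pi\<in>couplings Q1 Q2. \<integral>\<^sup>+ z. ennreal ((norm (fst z - snd z))\<^sup>2) \<partial>Pi)"

definition ambiguity_set :: "real \<Rightarrow> nat \<Rightarrow> (nat \<Rightarrow> real^'m) \<Rightarrow> (real^'m) measure set" where
  "ambiguity_set \<epsilon> K \<xi> = {Q. sets Q = sets borel \<and> prob_space Q \<and>
     wasserstein2 Q (empirical K \<xi>) \<le> ennreal \<epsilon>}"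

section \<open>The distributionally robust game\<close>

text \<open>Agents are the elements of the finite type \<open>'i\<close>. A function of \<open>(x\<^sub>i, x\<^sub>-\<^sub>i)\<close> is a function
  of the full profile. A choice of \<open>x\<^sub>-\<^sub>i\<close> is given by any profile \<open>x\<close> whose \<open>i\<close>-th entry is ignored:
  agent \<open>i\<close>'s problem only looks at the profiles \<open>with_decision x i y\<close>, that is \<open>(y, x\<^sub>-\<^sub>i)\<close>.\<close>

definition with_decision :: "(real^'n)^'i \<Rightarrow> 'i \<Rightarrow> real^'n \<Rightarrow> (real^'n)^'i" where
  "with_decision x i y = (\<chi> j. if j = i then y else x $ j)"

definition opponents :: "('i \<Rightarrow> (real^'n) set) \<Rightarrow> 'i \<Rightarrow> ((real^'n)^'i) set" where
  "opponents X i = {x. \<forall>j. j \<noteq> i \<longrightarrow> x $ j \<in> X j}"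

text \<open>The profile as a single vector with \<open>CARD('i) * CARD('n)\<close> real entries.\<close>

definition stacked :: "(real^'n)^'i \<Rightarrow> real^('i \<times> 'n)" where
  "stacked x = (\<chi> p. x $ fst p $ snd p)"

text \<open>The Bochner integral below is the expectation only for integrable integrands. Members of the
  ambiguity set have finite second moments, so this covers \<open>g i x\<close> quadratic.\<close>

definition worst_case ::
    "('i \<Rightarrow> (real^'n)^'i \<Rightarrow> real) \<Rightarrow> ('i \<Rightarrow> (real^'n)^'i \<Rightarrow> real^'m \<Rightarrow> real) \<Rightarrow>
     ('i \<Rightarrow> real) \<Rightarrow> ('i \<Rightarrow> nat) \<Rightarrow> ('i \<Rightarrow> nat \<Rightarrow> real^'m) \<Rightarrow> 'i \<Rightarrow> (real^'n)^'i \<Rightarrow> ereal" where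
  "worst_case f g \<epsilon> K \<xi> i x =
     (SUP Q\<in>ambiguity_set (\<epsilon> i) (K i) (\<xi> i). ereal (f i x + (\<integral>\<zeta>. g i x \<zeta> \<partial>Q)))"

definition optimal_value_G ::
    "('i \<Rightarrow> (real^'n) set) \<Rightarrow>
     ('i \<Rightarrow> (real^'n)^'i \<Rightarrow> real) \<Rightarrow> ('i \<Rightarrow> (real^'n)^'i \<Rightarrow> real^'m \<Rightarrow> real) \<Rightarrow>
     ('i \<Rightarrow> real) \<Rightarrow> ('i \<Rightarrow> nat) \<Rightarrow> ('i \<Rightarrow> nat \<Rightarrow> real^'m) \<Rightarrow> 'i \<Rightarrow> (real^'n)^'i \<Rightarrow> ereal" where
  "optimal_value_G X f g \<epsilon> K \<xi> i x =
     (INF y\<in>X i. worst_case f g \<epsilon> K \<xi> i (with_decision x i y))"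

definition dr_nash_equilibrium ::
    "('i \<Rightarrow> (real^'n) set) \<Rightarrow>
     ('i \<Rightarrow> (real^'n)^'i \<Rightarrow> real) \<Rightarrow> ('i \<Rightarrow> (real^'n)^'i \<Rightarrow> real^'m \<Rightarrow> real) \<Rightarrow>
     ('i \<Rightarrow> real) \<Rightarrow> ('i \<Rightarrow> nat) \<Rightarrow> ('i \<Rightarrow> nat \<Rightarrow> real^'m) \<Rightarrow> (real^'n)^'i \<Rightarrow> bool" where
  "dr_nash_equilibrium X f g \<epsilon> K \<xi> x \<longleftrightarrow>
     (\<forall>i. is_arg_min (\<lambda>y. worst_case f g \<epsilon> K \<xi> i (with_decision x i y)) (\<lambda>y. y \<in> X i) (x $ i))"

section \<open>The reformulated game\<close>

definition Q_tilde :: "real^'m^'m \<Rightarrow> real \<Rightarrow> real^'m^'m" where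
  "Q_tilde D l = matrix_inv (l *\<^sub>R mat 1 - D)"

definition P_tilde :: "real^'m^'m \<Rightarrow> ((real^'n)^'i \<Rightarrow> real^'m) \<Rightarrow> (real^'n)^'i \<Rightarrow> real^'m" where
  "P_tilde L P x = L *v P x"

definition xi_tilde :: "real^'m^'m \<Rightarrow> (nat \<Rightarrow> real^'m) \<Rightarrow> nat \<Rightarrow> real^'m" where
  "xi_tilde L \<xi> k = L *v \<xi> k"

definition W_tilde ::
    "real^'m^'m \<Rightarrow> ((real^'n)^'i \<Rightarrow> real^'m) \<Rightarrow> (nat \<Rightarrow> real^'m) \<Rightarrow>
     nat \<Rightarrow> (real^'n)^'i \<Rightarrow> real \<Rightarrow> real^'m" where
  "W_tilde L P \<xi> k x l = P_tilde L P x + (2 * l) *\<^sub>R xi_tilde L \<xi> k"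

definition objective_GR ::
    "('i \<Rightarrow> (real^'n)^'i \<Rightarrow> real) \<Rightarrow> ('i \<Rightarrow> (real^'n)^'i \<Rightarrow> real^'m) \<Rightarrow>
     ('i \<Rightarrow> real^'m^'m) \<Rightarrow> ('i \<Rightarrow> real^'m^'m) \<Rightarrow>
     ('i \<Rightarrow> real) \<Rightarrow> ('i \<Rightarrow> nat) \<Rightarrow> ('i \<Rightarrow> nat \<Rightarrow> real^'m) \<Rightarrow>
     'i \<Rightarrow> (real^'n)^'i \<Rightarrow> real \<Rightarrow> real" where
  "objective_GR f P L D \<epsilon> K \<xi> i x l =
     f i x
     + l * ((\<epsilon> i)\<^sup>2 - 1 / real (K i) * (\<Sum>k=1..K i. \<xi> i k \<bullet> \<xi> i k))
     + 1 / (4 * real (K i)) *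
         (\<Sum>k=1..K i. W_tilde (L i) (P i) (\<xi> i) k x l \<bullet>
                        (Q_tilde (D i) l *v W_tilde (L i) (P i) (\<xi> i) k x l))"

definition optimal_value_GR ::
    "('i \<Rightarrow> (real^'n) set) \<Rightarrow>
     ('i \<Rightarrow> (real^'n)^'i \<Rightarrow> real) \<Rightarrow> ('i \<Rightarrow> (real^'n)^'i \<Rightarrow> real^'m) \<Rightarrow>
     ('i \<Rightarrow> real^'m^'m) \<Rightarrow> ('i \<Rightarrow> real^'m^'m) \<Rightarrow> ('i \<Rightarrow> real^'m^'m) \<Rightarrow>
     ('i \<Rightarrow> real) \<Rightarrow> ('i \<Rightarrow> nat) \<Rightarrow> ('i \<Rightarrow> nat \<Rightarrow> real^'m) \<Rightarrow> 'i \<Rightarrow> (real^'n)^'i \<Rightarrow> ereal" where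
  "optimal_value_GR X f P Q L D \<epsilon> K \<xi> i x =
     (INF (y, l)\<in>X i \<times> {lambda_max (Q i)<..}.
        ereal (objective_GR f P L D \<epsilon> K \<xi> i (with_decision x i y) l))"

definition nash_equilibrium_GR ::
    "('i \<Rightarrow> (real^'n) set) \<Rightarrow>
     ('i \<Rightarrow> (real^'n)^'i \<Rightarrow> real) \<Rightarrow> ('i \<Rightarrow> (real^'n)^'i \<Rightarrow> real^'m) \<Rightarrow>
     ('i \<Rightarrow> real^'m^'m) \<Rightarrow> ('i \<Rightarrow> real^'m^'m) \<Rightarrow> ('i \<Rightarrow> real^'m^'m) \<Rightarrow>
     ('i \<Rightarrow> real) \<Rightarrow> ('i \<Rightarrow> nat) \<Rightarrow> ('i \<Rightarrow> nat \<Rightarrow> real^'m) \<Rightarrow>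
     (real^'n)^'i \<Rightarrow> ('i \<Rightarrow> real) \<Rightarrow> bool" where
  "nash_equilibrium_GR X f P Q L D \<epsilon> K \<xi> x lam \<longleftrightarrow>
     (\<forall>i. is_arg_min (\<lambda>(y, l). objective_GR f P L D \<epsilon> K \<xi> i (with_decision x i y) l)
            (\<lambda>z. z \<in> X i \<times> {lambda_max (Q i)<..}) (x $ i, lam i))"

section \<open>Consistency of the definitions\<close>

lemma ennreal_sqrt_power2: "(ennreal_sqrt c)\<^sup>2 = c"
  by (cases c) (auto simp: ennreal_sqrt_def ennreal_power)

lemma emeasure_empirical:
  assumes "1 \<le> K" "A \<in> sets borel"
  shows "emeasure (empirical K \<xi>) A = ennreal (1 / real K * (\<Sum>k=1..K. indicator A (\<xi> k)))"
proof -
  have sp: "space (uniform_count_measure {1..K}) = {1..K}"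
    and st: "sets (uniform_count_measure {1..K}) = Pow {1..K}"
    by (simp_all add: space_uniform_count_measure sets_uniform_count_measure)
  have m: "\<xi> \<in> uniform_count_measure {1..K} \<rightarrow>\<^sub>M borel"
    by (rule measurableI) (auto simp: sp st)
  have c: "(\<Sum>k=1..K. indicator A (\<xi> k) :: real) = real (card (\<xi> -` A \<inter> {1..K}))"
    by (simp add: indicator_def sum.If_cases Int_def conj_commute vimage_def)
  have "emeasure (empirical K \<xi>) A = emeasure (uniform_count_measure {1..K}) (\<xi> -` A \<inter> {1..K})"
    unfolding empirical_def by (subst emeasure_distr[OF m assms(2)]) (simp only: sp)
  also have "\<dots> = ennreal (real (card (\<xi> -` A \<inter> {1..K})) / real (card {1..K}))"
    by (rule emeasure_uniform_count_measure) auto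
  finally show ?thesis unfolding c by simp
qed

lemma diagonal_mult_vec:
  assumes "is_diagonal D"
  shows "(D *v v) $ j = D $ j $ j * v $ j"
proof -
  have "(D *v v) $ j = (\<Sum>k\<in>UNIV. if k = j then D $ j $ j * v $ j else 0)"
    unfolding matrix_vector_mult_def vec_lambda_beta
    by (intro sum.cong) (use assms in \<open>auto simp: is_diagonal_def\<close>)
  then show ?thesis by simp
qed

lemma eigenvals_diagonal:
  assumes "is_diagonal D"
  shows "eigenvals D = range (\<lambda>j. D $ j $ j)"
proof (intro subset_antisym subsetI)
  fix c assume "c \<in> eigenvals D"
  then obtain v where v: "v \<noteq> 0" "D *v v = c *\<^sub>R v" by (auto simp: eigenvals_def)
  then obtain j where j: "v $ j \<noteq> 0" by (auto simp: vec_eq_iff)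
  have "(D *v v) $ j = D $ j $ j * v $ j"
    by (rule diagonal_mult_vec[OF assms])
  then have "c * v $ j = D $ j $ j * v $ j"
    unfolding v(2) by simp
  with j have "c = D $ j $ j" by (metis mult_right_cancel)
  then show "c \<in> range (\<lambda>j. D $ j $ j)" by auto
next
  fix c assume "c \<in> range (\<lambda>j. D $ j $ j)"
  then obtain j where c: "c = D $ j $ j" by auto
  have "D *v axis j 1 = c *\<^sub>R axis j 1"
    by (simp add: vec_eq_iff diagonal_mult_vec[OF assms] c axis_def)
  moreover have "axis j 1 \<noteq> (0 :: real^'a)" by (simp add: axis_eq_0_iff)
  ultimately show "c \<in> eigenvals D" unfolding eigenvals_def by blast
qed

lemma lambda_max_min_sorted:
  assumes "is_diagonal D" "decreasing_diagonal D"
  shows "lambda_max D = D $ Min UNIV $ Min UNIV" "lambda_min D = D $ Max UNIV $ Max UNIV"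
  unfolding lambda_max_def lambda_min_def eigenvals_diagonal[OF assms(1)]
  using assms(2) by (auto intro!: Max_eqI Min_eqI simp: decreasing_diagonal_def)

lemma Q_tilde_diagonal:
  assumes "is_diagonal D" "lambda_max D < l"
  shows "Q_tilde D l = (\<chi> j k. if j = k then 1 / (l - D $ j $ j) else 0)"
proof -
  let ?A = "l *\<^sub>R mat 1 - D" and ?B = "\<chi> j k. if j = k then 1 / (l - D $ j $ j) else (0::real)"
  have lt: "D $ j $ j < l" for j
    using assms(2) unfolding lambda_max_def eigenvals_diagonal[OF assms(1)]
    by (auto simp: Max_less_iff)
  have dA: "is_diagonal ?A" and dB: "is_diagonal ?B"
    using assms(1) by (auto simp: is_diagonal_def mat_def)
  have nz: "l - D $ j $ j \<noteq> 0" for j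
    using lt[of j] by simp
  have dm: "?A $ j $ j = l - D $ j $ j" "?B $ j $ j = 1 / (l - D $ j $ j)" for j
    by (simp_all add: mat_def)
  have ABv: "?A *v (?B *v v) = v" and BAv: "?B *v (?A *v v) = v" for v
    unfolding vec_eq_iff diagonal_mult_vec[OF dA] diagonal_mult_vec[OF dB] dm
    by (simp_all only: times_divide_eq_right times_divide_eq_left mult_1_left
        nonzero_mult_div_cancel_left[OF nz] simp_thms)
  have AB: "?A ** ?B = mat 1"
    unfolding matrix_eq matrix_vector_mul_assoc[symmetric] matrix_vector_mul_lid by (intro allI ABv)
  have BA: "?B ** ?A = mat 1"
    unfolding matrix_eq matrix_vector_mul_assoc[symmetric] matrix_vector_mul_lid by (intro allI BAv)
  have inv: "?A ** Q_tilde D l = mat 1 \<and> Q_tilde D l ** ?A = mat 1"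
    unfolding Q_tilde_def matrix_inv_def by (rule someI[where x = ?B]) (rule conjI[OF AB BA])
  have "Q_tilde D l = Q_tilde D l ** (?A ** ?B)"
    unfolding AB by (rule matrix_mul_rid[symmetric])
  also have "\<dots> = ?B"
    unfolding matrix_mul_assoc conjunct2[OF inv] by (rule matrix_mul_lid)
  finally show ?thesis .
qed

end

theory Submission
  imports Defs "HOL-Real_Asymp.Real_Asymp"
begin

text \<open>
  For a fixed profile the worst case is a concave maximisation over the Wasserstein ball, and the
  reformulated objective is its Lagrangian dual; everything else is interchanging infima.
  In the eigencoordinates of \<open>Q\<^sub>i\<close>, write \<open>c\<^sub>k\<^sub>j\<close> for half the \<open>j\<close>-th partial derivative
  of the cost at the \<open>k\<close>-th sample and \<open>C\<^sub>j\<close> for the mean of \<open>c\<^sub>k\<^sub>j\<close> squared over \<open>k\<close>. The dual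
  function is \<open>l * \<epsilon>\<^sup>2\<close>, plus the empirical mean cost, plus \<open>\<Sum>j. C\<^sub>j / (l - d\<^sub>j)\<close>. Weak duality
  integrates a pointwise quadratic inequality against a nearly optimal coupling. For the converse,
  moving every sample by \<open>c\<^sub>k\<^sub>j / (l - d\<^sub>j)\<close> has squared transport cost \<open>\<Sum>j. C\<^sub>j / (l - d\<^sub>j)\<^sup>2\<close>; if this
  equals \<open>\<epsilon>\<^sup>2\<close> for some \<open>l\<close> above the top eigenvalue, the moved samples attain the dual value at \<open>l\<close>.
  If it stays below \<open>\<epsilon>\<^sup>2\<close>, then \<open>C\<^sub>j\<close> vanishes in the top eigenspace and the unused budget is spent on
  a shift along a top eigenvector, which attains the limit of the dual at the top eigenvalue. In the
  remaining case \<open>\<epsilon> = 0\<close> the dual tends to the empirical mean cost as \<open>l\<close> grows.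
\<close>

section \<open>Empirical measures and couplings\<close>

text \<open>Trades the metric for its square, so that balls are handled through the transport cost
  and no root remains.\<close>

lemma ennreal_sqrt_le_iff:
  assumes "0 \<le> e"
  shows "ennreal_sqrt c \<le> ennreal e \<longleftrightarrow> c \<le> ennreal (e\<^sup>2)"
proof (cases c)
  case (real r)
  then show ?thesis
    using assms real_sqrt_le_iff[of r "e\<^sup>2"] by (auto simp: ennreal_sqrt_def)
qed (auto simp: ennreal_sqrt_def top_unique)

lemma measurable_uniform_count_measure:
  assumes "space M = UNIV"
  shows "\<xi> \<in> uniform_count_measure A \<rightarrow>\<^sub>M M"
  by (rule measurableI)
    (auto simp: assms space_uniform_count_measure sets_uniform_count_measure)

lemma sets_empirical [simp]: "sets (empirical K \<xi>) = sets borel"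
  by (simp add: empirical_def)

lemma prob_space_empirical:
  assumes "1 \<le> K"
  shows "prob_space (empirical K \<xi>)"
  unfolding empirical_def using assms
  by (intro prob_space.prob_space_distr prob_space_uniform_count_measure
      measurable_uniform_count_measure) auto

lemma integral_empirical:
  fixes h :: "real^'m \<Rightarrow> real"
  assumes "h \<in> borel_measurable borel"
  shows "(\<integral>\<zeta>. h \<zeta> \<partial>empirical K \<xi>) = (\<Sum>k=1..K. h (\<xi> k)) / real K"
  unfolding empirical_def using assms
  by (subst integral_distr[OF measurable_uniform_count_measure])
    (auto simp: integral_uniform_count_measure)

lemma integrable_empirical:
  fixes h :: "real^'m \<Rightarrow> real"
  assumes "h \<in> borel_measurable borel"
  shows "integrable (empirical K \<xi>) h"
  unfolding empirical_def using assms
  by (subst integrable_distr_eq[OF measurable_uniform_count_measure])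
    (auto simp: uniform_count_measure_def intro!: integrable_point_measure_finite)

text \<open>Pairing each moved sample with its original is a coupling. It need not be optimal, but
  its cost bounds the infimum from above.\<close>

lemma empirical_in_ambiguity_set:
  fixes \<xi> \<eta> :: "nat \<Rightarrow> real^'m"
  assumes "1 \<le> K" "0 \<le> \<epsilon>"
    and budget: "(\<Sum>k=1..K. (norm (\<eta> k - \<xi> k))\<^sup>2) / real K \<le> \<epsilon>\<^sup>2"
  shows "empirical K \<eta> \<in> ambiguity_set \<epsilon> K \<xi>"
proof -
  let ?U = "uniform_count_measure {1..K}"
  define Pi :: "((real^'m) \<times> (real^'m)) measure"
    where "Pi = distr ?U (borel \<Otimes>\<^sub>M borel) (\<lambda>k. (\<eta> k, \<xi> k))"
  have m: "(\<lambda>k. (\<eta> k, \<xi> k)) \<in> ?U \<rightarrow>\<^sub>M borel \<Otimes>\<^sub>M borel"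
    by (rule measurable_uniform_count_measure) (simp add: space_pair_measure)
  have "prob_space ?U"
    using assms(1) by (intro prob_space_uniform_count_measure) auto
  then have "prob_space Pi"
    unfolding Pi_def using m by (rule prob_space.prob_space_distr)
  moreover have "distr Pi borel fst = empirical K \<eta>" "distr Pi borel snd = empirical K \<xi>"
    unfolding Pi_def empirical_def by (simp_all add: distr_distr[OF _ m] o_def del: One_nat_def)
  ultimately have c: "Pi \<in> couplings (empirical K \<eta>) (empirical K \<xi>)"
    by (auto simp: couplings_def Pi_def)
  have "(\<integral>\<^sup>+ z. ennreal ((norm (fst z - snd z))\<^sup>2) \<partial>Pi)
      = (\<integral>\<^sup>+ k. ennreal ((norm (\<eta> k - \<xi> k))\<^sup>2) \<partial>?U)"
    unfolding Pi_def by (subst nn_integral_distr[OF m]) auto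
  also have "\<dots> = (\<Sum>k=1..K. ennreal (1 / real K) * ennreal ((norm (\<eta> k - \<xi> k))\<^sup>2))"
    unfolding uniform_count_measure_def
    by (subst nn_integral_point_measure_finite) (auto simp: mult.commute divide_ennreal_def)
  also have "\<dots> = ennreal ((\<Sum>k=1..K. (norm (\<eta> k - \<xi> k))\<^sup>2) / real K)"
    by (simp add: ennreal_mult[symmetric] sum_divide_distrib)
  also have "\<dots> \<le> ennreal (\<epsilon>\<^sup>2)"
    using budget by (rule ennreal_leI)
  finally have "(\<integral>\<^sup>+ z. ennreal ((norm (fst z - snd z))\<^sup>2) \<partial>Pi) \<le> ennreal (\<epsilon>\<^sup>2)" .
  with c have "wasserstein2 (empirical K \<eta>) (empirical K \<xi>) \<le> ennreal \<epsilon>"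
    unfolding wasserstein2_def ennreal_sqrt_le_iff[OF assms(2)] by (rule INF_lower2)
  then show ?thesis
    using assms(1) by (simp add: ambiguity_set_def prob_space_empirical)
qed

text \<open>The infimum over couplings is only approached, hence the slack \<open>\<delta>\<close>.
  Finite cost allows the passage from \<open>nn_integral\<close> to the Bochner integral.\<close>

lemma ambiguity_set_coupling:
  assumes "Q \<in> ambiguity_set \<epsilon> K \<xi>" "0 \<le> \<epsilon>" "0 < \<delta>"
  obtains Pi where "Pi \<in> couplings Q (empirical K \<xi>)"
    "integrable Pi (\<lambda>z. (norm (fst z - snd z))\<^sup>2)"
    "(\<integral>z. (norm (fst z - snd z))\<^sup>2 \<partial>Pi) \<le> \<epsilon>\<^sup>2 + \<delta>"
proof -
  let ?I = "\<lambda>Pi. \<integral>\<^sup>+ z. ennreal ((norm (fst z - snd z))\<^sup>2) \<partial>Pi"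
  have "(INF Pi\<in>couplings Q (empirical K \<xi>). ?I Pi) \<le> ennreal (\<epsilon>\<^sup>2)"
    using assms(1) unfolding ambiguity_set_def wasserstein2_def ennreal_sqrt_le_iff[OF assms(2)]
    by blast
  also have "\<dots> < ennreal (\<epsilon>\<^sup>2 + \<delta>)"
    using assms(3) by (intro ennreal_lessI) (auto intro: add_nonneg_pos)
  finally obtain Pi where Pi: "Pi \<in> couplings Q (empirical K \<xi>)" "?I Pi < ennreal (\<epsilon>\<^sup>2 + \<delta>)"
    by (auto simp: INF_less_iff)
  have [measurable_cong]: "sets Pi = sets (borel \<Otimes>\<^sub>M borel)"
    using Pi(1) by (simp add: couplings_def)
  have fin: "?I Pi < \<infinity>"
    using Pi(2) by (rule less_trans) simp
  have int: "integrable Pi (\<lambda>z. (norm (fst z - snd z))\<^sup>2)"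
    using fin by (intro integrableI_nonneg) auto
  then have "ennreal (\<integral>z. (norm (fst z - snd z))\<^sup>2 \<partial>Pi) = ?I Pi"
    by (subst nn_integral_eq_integral) auto
  also have "\<dots> \<le> ennreal (\<epsilon>\<^sup>2 + \<delta>)"
    using Pi(2) by simp
  finally have "(\<integral>z. (norm (fst z - snd z))\<^sup>2 \<partial>Pi) \<le> \<epsilon>\<^sup>2 + \<delta>"
    using assms(3) by (subst (asm) ennreal_le_iff) auto
  with Pi(1) int show thesis by (rule that)
qed

text \<open>Here \<open>\<phi>\<close> dominates the supremum over \<open>\<zeta>\<close> of
  \<open>h \<zeta>\<close> minus the penalty. The bound \<open>growth\<close> makes \<open>h\<close>
  integrable, so that its integral is a genuine expectation and not the default 0.\<close>

lemma ambiguity_set_weak_duality: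
  fixes h \<phi> :: "real^'m \<Rightarrow> real"
  assumes "Q \<in> ambiguity_set \<epsilon> K \<xi>" "0 \<le> \<epsilon>" "0 \<le> l"
    and meas: "h \<in> borel_measurable borel" "\<phi> \<in> borel_measurable borel"
    and growth: "\<And>\<zeta>. \<bar>h \<zeta>\<bar> \<le> B * (1 + (norm \<zeta>)\<^sup>2)"
    and le: "\<And>\<zeta> \<eta>. h \<zeta> \<le> \<phi> \<eta> + l * (norm (\<zeta> - \<eta>))\<^sup>2"
  shows "(\<integral>\<zeta>. h \<zeta> \<partial>Q) \<le> l * \<epsilon>\<^sup>2 + (\<Sum>k=1..K. \<phi> (\<xi> k)) / real K"
proof -
  let ?S = "(\<Sum>k=1..K. \<phi> (\<xi> k)) / real K"
  note [measurable] = meas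
  have "0 \<le> B"
    using order_trans[OF abs_ge_zero growth[of 0]] by simp
  have approx: "(\<integral>\<zeta>. h \<zeta> \<partial>Q) \<le> l * \<epsilon>\<^sup>2 + ?S + l * \<delta>" if "0 < \<delta>" for \<delta>
  proof -
    let ?D = "\<lambda>z :: (real^'m) \<times> (real^'m). (norm (fst z - snd z))\<^sup>2"
    obtain Pi where Pi: "Pi \<in> couplings Q (empirical K \<xi>)" "integrable Pi ?D"
        "(\<integral>z. ?D z \<partial>Pi) \<le> \<epsilon>\<^sup>2 + \<delta>"
      using ambiguity_set_coupling[OF assms(1,2) \<open>0 < \<delta>\<close>] by blast
    have [measurable_cong]: "sets Pi = sets (borel \<Otimes>\<^sub>M borel)"
      and Q: "Q = distr Pi borel fst" and E: "empirical K \<xi> = distr Pi borel snd"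
      and "prob_space Pi"
      using Pi(1) by (auto simp: couplings_def)
    interpret prob_space Pi by fact
    have snd_int: "integrable Pi (\<lambda>z. \<psi> (snd z))"
      "(\<integral>z. \<psi> (snd z) \<partial>Pi) = (\<Sum>k=1..K. \<psi> (\<xi> k)) / real K"
      if [measurable]: "\<psi> \<in> borel_measurable borel" for \<psi> :: "real^'m \<Rightarrow> real"
    proof -
      show "integrable Pi (\<lambda>z. \<psi> (snd z))"
        using integrable_empirical[OF that, of K \<xi>] unfolding E
        by (subst (asm) integrable_distr_eq) auto
      show "(\<integral>z. \<psi> (snd z) \<partial>Pi) = (\<Sum>k=1..K. \<psi> (\<xi> k)) / real K"
        using integral_empirical[OF that, of K \<xi>] unfolding E
        by (subst (asm) integral_distr) auto
    qed
    \<comment> \<open>Controls the second moment of the first marginal by the transport cost and the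
      second moment of the samples.\<close>
    have sq: "(norm a)\<^sup>2 \<le> 2 * (norm (a - c))\<^sup>2 + 2 * (norm c)\<^sup>2" for a c :: "real^'m"
    proof -
      have "norm a \<le> norm (a - c) + norm c"
        using norm_triangle_ineq[of "a - c" c] by simp
      then have "(norm a)\<^sup>2 \<le> (norm (a - c) + norm c)\<^sup>2"
        by (intro power_mono) auto
      also have "\<dots> \<le> 2 * (norm (a - c))\<^sup>2 + 2 * (norm c)\<^sup>2"
        using zero_le_power2[of "norm (a - c) - norm c"] by (simp add: power2_eq_square algebra_simps)
      finally show ?thesis .
    qed
    have int: "integrable Pi (\<lambda>z. h (fst z))"
    proof (rule Bochner_Integration.integrable_bound)
      show "integrable Pi (\<lambda>z. B * (1 + (2 * ?D z + 2 * (norm (snd z))\<^sup>2)))"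
      proof -
        have "integrable Pi (\<lambda>z. (norm (snd z))\<^sup>2)"
          by (rule snd_int(1)) simp
        with Pi(2) show ?thesis by simp
      qed
      show "AE z :: (real^'m) \<times> (real^'m) in Pi. norm (h (fst z)) \<le> norm (B * (1 + (2 * ?D z + 2 * (norm (snd z))\<^sup>2)))"
      proof (intro AE_I2)
        fix z :: "(real^'m) \<times> (real^'m)"
        have "norm (h (fst z)) \<le> B * (1 + (norm (fst z))\<^sup>2)"
          using growth by simp
        also have "\<dots> \<le> B * (1 + (2 * ?D z + 2 * (norm (snd z))\<^sup>2))"
          using sq[of "fst z" "snd z"] \<open>0 \<le> B\<close> by (intro mult_left_mono) auto
        finally show "norm (h (fst z)) \<le> norm (B * (1 + (2 * ?D z + 2 * (norm (snd z))\<^sup>2)))"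
          by simp
      qed
    qed simp
    have "(\<integral>\<zeta>. h \<zeta> \<partial>Q) = (\<integral>z. h (fst z) \<partial>Pi)"
      unfolding Q by (subst integral_distr) auto
    also have "\<dots> \<le> (\<integral>z. \<phi> (snd z) + l * ?D z \<partial>Pi)"
      using int snd_int(1)[OF meas(2)] Pi(2) le by (intro integral_mono) simp_all
    also have "\<dots> = ?S + l * (\<integral>z. ?D z \<partial>Pi)"
      using snd_int[OF meas(2)] Pi(2) by simp
    also have "\<dots> \<le> ?S + l * (\<epsilon>\<^sup>2 + \<delta>)"
      using Pi(3) \<open>0 \<le> l\<close> by (intro add_left_mono mult_left_mono) auto
    finally show ?thesis by (simp add: algebra_simps)
  qed
  have "((\<lambda>\<delta>. l * \<epsilon>\<^sup>2 + ?S + l * \<delta>) \<longlongrightarrow> l * \<epsilon>\<^sup>2 + ?S + l * 0) (at_right 0)"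
    by (intro tendsto_intros)
  moreover have "\<forall>\<^sub>F \<delta> in at_right 0. (\<integral>\<zeta>. h \<zeta> \<partial>Q) \<le> l * \<epsilon>\<^sup>2 + ?S + l * \<delta>"
    using eventually_at_right_less[of "0 :: real"] by eventually_elim (rule approx)
  ultimately have "(\<integral>\<zeta>. h \<zeta> \<partial>Q) \<le> l * \<epsilon>\<^sup>2 + ?S + l * 0"
    by (rule tendsto_lowerbound) simp
  then show ?thesis by simp
qed

section \<open>Strong duality for a diagonalised quadratic cost\<close>

locale diagonalised_dro =
  fixes L :: "real^'m^'m" and d :: "'m \<Rightarrow> real" and q :: "real^'m"
    and \<epsilon> :: real and K :: nat and \<xi> :: "nat \<Rightarrow> real^'m"
  assumes L: "orthogonal_matrix L" and d_nonneg: "\<And>j. 0 \<le> d j"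
    and \<epsilon>_nonneg: "0 \<le> \<epsilon>" and K_pos: "1 \<le> K"
begin

section \<open>Cost, gradients and dual function in eigencoordinates\<close>

definition cost :: "real^'m \<Rightarrow> real" where
  "cost \<zeta> = (\<Sum>j\<in>UNIV. d j * ((L *v \<zeta>) $ j)\<^sup>2 + q $ j * (L *v \<zeta>) $ j)"

text \<open>The factor 1/2 is chosen so that \<open>2 * c * s - (l - d j) * s^2\<close>, with
  \<open>c\<close> this value and \<open>s\<close> a displacement, has maximum
  \<open>c^2 / (l - d j)\<close> for \<open>d j < l\<close>.\<close>

definition half_grad :: "real^'m \<Rightarrow> 'm \<Rightarrow> real" where
  "half_grad \<zeta> j = q $ j / 2 + d j * (L *v \<zeta>) $ j"

definition mean_sq_grad :: "'m \<Rightarrow> real" where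
  "mean_sq_grad j = (\<Sum>k=1..K. (half_grad (\<xi> k) j)\<^sup>2) / real K"

text \<open>At \<open>l = d j\<close> the quotient is 0 by convention. This is the right limit
  precisely when \<open>mean_sq_grad j\<close> vanishes, the only case in which \<open>dual\<close>
  is evaluated at the top eigenvalue.\<close>

definition dual :: "real \<Rightarrow> real" where
  "dual l = l * \<epsilon>\<^sup>2 + (\<Sum>k=1..K. cost (\<xi> k)) / real K + (\<Sum>j\<in>UNIV. mean_sq_grad j / (l - d j))"

definition top_eigenvalue :: real where
  "top_eigenvalue = Max (range d)"

lemma le_top_eigenvalue: "d j \<le> top_eigenvalue"
  by (simp add: top_eigenvalue_def)

lemma top_eigenvalue_attained: obtains j where "d j = top_eigenvalue"
proof -
  have "top_eigenvalue \<in> range d"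
    unfolding top_eigenvalue_def by (rule Max_in) auto
  with that show thesis by auto
qed

lemma mean_sq_grad_nonneg: "0 \<le> mean_sq_grad j"
  by (auto simp: mean_sq_grad_def intro!: divide_nonneg_nonneg sum_nonneg)

lemma norm_L: "norm (L *v \<zeta>) = norm \<zeta>"
  using L by (intro orthogonal_transformation_norm) (simp add: orthogonal_transformation_matrix)

lemma norm_diff_sq: "(norm (\<zeta> - \<eta>))\<^sup>2 = (\<Sum>j\<in>UNIV. ((L *v \<zeta>) $ j - (L *v \<eta>) $ j)\<^sup>2)"
proof -
  have "(norm (\<zeta> - \<eta>))\<^sup>2 = (norm (L *v \<zeta> - L *v \<eta>))\<^sup>2"
    by (simp add: norm_L flip: matrix_vector_mult_diff_distrib)
  then show ?thesis
    by (simp only: power2_norm_eq_inner) (simp add: inner_vec_def power2_eq_square)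
qed

lemma borel_measurable_coordinate [measurable]: "(\<lambda>\<zeta>. (L *v \<zeta>) $ j) \<in> borel_measurable borel"
  by (intro borel_measurable_continuous_onI continuous_intros
      linear_continuous_on linear_linear[THEN iffD1] matrix_vector_mul_linear)

lemma borel_measurable_cost [measurable]: "cost \<in> borel_measurable borel"
  unfolding cost_def[abs_def] by measurable

lemma borel_measurable_half_grad [measurable]: "(\<lambda>\<zeta>. half_grad \<zeta> j) \<in> borel_measurable borel"
  unfolding half_grad_def by measurable

lemma cost_growth: "\<bar>cost \<zeta>\<bar> \<le> (\<Sum>j\<in>UNIV. d j + \<bar>q $ j\<bar>) * (1 + (norm \<zeta>)\<^sup>2)"
proof -
  have "\<bar>d j * y\<^sup>2 + q $ j * y\<bar> \<le> (d j + \<bar>q $ j\<bar>) * (1 + (norm \<zeta>)\<^sup>2)"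
    if y: "\<bar>y\<bar> \<le> norm \<zeta>" for j y
  proof -
    have y2: "y\<^sup>2 \<le> (norm \<zeta>)\<^sup>2"
      using power_mono[OF y, of 2] by simp
    have "\<bar>y\<bar> \<le> 1 + y\<^sup>2"
      using zero_le_power2[of "\<bar>y\<bar> - 1"] by (simp add: power2_diff)
    then have y1: "\<bar>y\<bar> \<le> 1 + (norm \<zeta>)\<^sup>2"
      using y2 by simp
    have "\<bar>d j * y\<^sup>2 + q $ j * y\<bar> \<le> d j * y\<^sup>2 + \<bar>q $ j\<bar> * \<bar>y\<bar>"
      using d_nonneg[of j] by (intro order_trans[OF abs_triangle_ineq]) (simp add: abs_mult)
    also have "\<dots> \<le> d j * (1 + (norm \<zeta>)\<^sup>2) + \<bar>q $ j\<bar> * (1 + (norm \<zeta>)\<^sup>2)"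
      using d_nonneg[of j] y1 y2 by (intro add_mono mult_left_mono) auto
    finally show ?thesis by (simp add: algebra_simps)
  qed
  moreover have "\<bar>(L *v \<zeta>) $ j\<bar> \<le> norm \<zeta>" for j
    using component_le_norm_cart[of "L *v \<zeta>" j] by (simp add: norm_L)
  ultimately show ?thesis
    unfolding cost_def sum_distrib_right by (intro order_trans[OF sum_abs] sum_mono) auto
qed

text \<open>Exchanging the sums gives the form per sample, which fits pointwise arguments; the form
  per coordinate serves the limits in \<open>l\<close>.\<close>

lemma dual_eq: "dual l = l * \<epsilon>\<^sup>2 +
    (\<Sum>k=1..K. cost (\<xi> k) + (\<Sum>j\<in>UNIV. (half_grad (\<xi> k) j)\<^sup>2 / (l - d j))) / real K"
proof -
  have "(\<Sum>j\<in>UNIV. mean_sq_grad j / (l - d j))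
      = (\<Sum>j\<in>UNIV. \<Sum>k=1..K. (half_grad (\<xi> k) j)\<^sup>2 / (l - d j) / real K)"
    by (simp add: mean_sq_grad_def sum_divide_distrib divide_divide_eq_left mult.commute)
  also have "\<dots> = (\<Sum>k=1..K. \<Sum>j\<in>UNIV. (half_grad (\<xi> k) j)\<^sup>2 / (l - d j) / real K)"
    by (rule sum.swap)
  finally show ?thesis
    by (simp add: dual_def sum.distrib add_divide_distrib sum_divide_distrib)
qed

section \<open>Weak duality\<close>

lemma weak_duality:
  assumes "top_eigenvalue < l" "Q \<in> ambiguity_set \<epsilon> K \<xi>"
  shows "(\<integral>\<zeta>. cost \<zeta> \<partial>Q) \<le> dual l"
  unfolding dual_eq
proof (rule ambiguity_set_weak_duality[OF assms(2) \<epsilon>_nonneg _ _ _ cost_growth])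
  have lt: "d j < l" for j
    using le_top_eigenvalue assms(1) by (rule le_less_trans)
  show "0 \<le> l"
    using lt d_nonneg by (meson less_eq_real_def order_le_less_trans)
  \<comment> \<open>With \<open>c = p / 2 + a * u\<close>, the gap between the two sides is the
    square \<open>(c - (l - a) * (t - u))^2 / (l - a)\<close>.\<close>
  have coord: "a * t\<^sup>2 + p * t \<le> a * u\<^sup>2 + p * u + (p / 2 + a * u)\<^sup>2 / (l - a) + l * (t - u)\<^sup>2"
    if "a < l" for a p t u :: real
  proof -
    define c where "c = p / 2 + a * u"
    have p: "p = 2 * (c - a * u)"
      by (simp add: c_def)
    have "0 \<le> (c - (l - a) * (t - u))\<^sup>2 / (l - a)"
      using that by simp
    also have "\<dots> = c\<^sup>2 / (l - a) - 2 * c * (t - u) + (l - a) * (t - u)\<^sup>2"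
      using that by (simp add: field_simps power2_eq_square)
    finally have "2 * c * (t - u) - (l - a) * (t - u)\<^sup>2 \<le> c\<^sup>2 / (l - a)"
      by simp
    then show ?thesis
      unfolding c_def[symmetric] unfolding p by (simp add: algebra_simps power2_eq_square)
  qed
  show "cost \<zeta> \<le> cost \<eta> + (\<Sum>j\<in>UNIV. (half_grad \<eta> j)\<^sup>2 / (l - d j)) + l * (norm (\<zeta> - \<eta>))\<^sup>2"
    for \<zeta> \<eta>
    unfolding cost_def half_grad_def norm_diff_sq sum_distrib_left sum.distrib[symmetric]
    by (intro sum_mono coord lt)
qed measurable

text \<open>The hypothesis \<open>opt\<close> is the first-order condition for maximising the Lagrangian at each
  sample; for \<open>l\<close> equal to the top eigenvalue it leaves the top eigendirections free.\<close>

lemma dual_le_if_stationary: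
  fixes w :: "nat \<Rightarrow> real^'m"
  assumes opt: "\<And>k j. k \<in> {1..K} \<Longrightarrow> (l - d j) * w k $ j = half_grad (\<xi> k) j"
    and budget: "(\<Sum>k=1..K. \<Sum>j\<in>UNIV. (w k $ j)\<^sup>2) / real K = \<epsilon>\<^sup>2"
  shows "\<exists>Q\<in>ambiguity_set \<epsilon> K \<xi>. dual l \<le> (\<integral>\<zeta>. cost \<zeta> \<partial>Q)"
proof -
  \<comment> \<open>The displacement \<open>w k\<close> is given in eigencoordinates and is rotated
    back by the transpose.\<close>
  define \<eta> where "\<eta> k = \<xi> k + transpose L *v w k" for k
  have L\<eta>: "L *v \<eta> k = L *v \<xi> k + w k" for k
    using L by (simp add: \<eta>_def matrix_vector_right_distrib matrix_vector_mul_assoc orthogonal_matrix_def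
        del: transpose_matrix_vector)
  have "(norm (\<eta> k - \<xi> k))\<^sup>2 = (\<Sum>j\<in>UNIV. (w k $ j)\<^sup>2)" for k
    unfolding norm_diff_sq L\<eta> by simp
  then have mem: "empirical K \<eta> \<in> ambiguity_set \<epsilon> K \<xi>"
    using budget by (intro empirical_in_ambiguity_set K_pos \<epsilon>_nonneg) simp
  have coord: "a * (u + v)\<^sup>2 + p * (u + v) = a * u\<^sup>2 + p * u + (p / 2 + a * u)\<^sup>2 / (l - a) + l * v\<^sup>2"
    if v: "(l - a) * v = p / 2 + a * u" for a p u v :: real
  proof -
    \<comment> \<open>For \<open>l = a\<close> both sides are 0: the left by division by zero, the
      right through its first factor.\<close>
    have sq: "(p / 2 + a * u)\<^sup>2 / (l - a) = (l - a) * v\<^sup>2"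
      unfolding v[symmetric] by (simp add: power2_eq_square)
    have p: "p = 2 * ((l - a) * v - a * u)"
      using v by simp
    have "p * v = 2 * (l - a) * v\<^sup>2 - 2 * a * u * v"
      unfolding p by (simp add: algebra_simps power2_eq_square)
    then show ?thesis
      unfolding sq by (simp add: algebra_simps power2_eq_square)
  qed
  have "cost (\<eta> k) = cost (\<xi> k) + (\<Sum>j\<in>UNIV. (half_grad (\<xi> k) j)\<^sup>2 / (l - d j))
      + l * (\<Sum>j\<in>UNIV. (w k $ j)\<^sup>2)" if "k \<in> {1..K}" for k
    unfolding cost_def half_grad_def sum_distrib_left sum.distrib[symmetric] L\<eta> vector_add_component
    by (intro sum.cong refl coord opt[OF that, unfolded half_grad_def])
  then have "(\<Sum>k=1..K. cost (\<eta> k)) = (\<Sum>k=1..K. cost (\<xi> k)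
      + (\<Sum>j\<in>UNIV. (half_grad (\<xi> k) j)\<^sup>2 / (l - d j)) + l * (\<Sum>j\<in>UNIV. (w k $ j)\<^sup>2))"
    by (rule sum.cong[OF refl])
  \<comment> \<open>The budget is spent exactly, so the penalties average to the term
    \<open>l * \<epsilon>^2\<close> of the dual.\<close>
  then have "(\<Sum>k=1..K. cost (\<eta> k)) / real K = dual l"
    unfolding dual_eq budget[symmetric]
    by (simp add: sum.distrib add_divide_distrib flip: sum_distrib_left)
  with mem show ?thesis
    by (intro bexI[of _ "empirical K \<eta>"]) (simp_all add: integral_empirical)
qed

section \<open>Worst-case distributions and their transport cost\<close>

text \<open>Above the top eigenvalue, \<open>\<epsilon>^2 - transport l\<close> is the derivative of
  \<open>dual\<close> at \<open>l\<close>; a solution of \<open>transport l = \<epsilon>^2\<close>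
  is thus a stationary multiplier.\<close>

definition transport :: "real \<Rightarrow> real" where
  "transport l = (\<Sum>j\<in>UNIV. mean_sq_grad j / (l - d j)\<^sup>2)"

lemma transport_eq:
  "transport l = (\<Sum>k=1..K. \<Sum>j\<in>UNIV. (half_grad (\<xi> k) j / (l - d j))\<^sup>2) / real K"
proof -
  have "transport l = (\<Sum>j\<in>UNIV. \<Sum>k=1..K. (half_grad (\<xi> k) j / (l - d j))\<^sup>2 / real K)"
    unfolding transport_def mean_sq_grad_def power_divide
    by (simp add: sum_divide_distrib divide_divide_eq_left mult.commute)
  also have "\<dots> = (\<Sum>k=1..K. \<Sum>j\<in>UNIV. (half_grad (\<xi> k) j / (l - d j))\<^sup>2 / real K)"
    by (rule sum.swap)
  finally show ?thesis by (simp add: sum_divide_distrib)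
qed

lemma dual_le_if_transport_eq:
  assumes "top_eigenvalue < l" "transport l = \<epsilon>\<^sup>2"
  shows "\<exists>Q\<in>ambiguity_set \<epsilon> K \<xi>. dual l \<le> (\<integral>\<zeta>. cost \<zeta> \<partial>Q)"
proof (rule dual_le_if_stationary)
  have "d j < l" for j
    using le_top_eigenvalue assms(1) by (rule le_less_trans)
  then show "(l - d j) * (\<chi> j. half_grad (\<xi> k) j / (l - d j)) $ j = half_grad (\<xi> k) j" for k j
    using less_imp_neq by fastforce
  show "(\<Sum>k=1..K. \<Sum>j\<in>UNIV. ((\<chi> j. half_grad (\<xi> k) j / (l - d j)) $ j)\<^sup>2) / real K = \<epsilon>\<^sup>2"
    using assms(2) by (simp add: transport_eq)
qed

lemma dual_top_le:
  assumes vanish: "\<And>j. d j = top_eigenvalue \<Longrightarrow> mean_sq_grad j = 0"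
    and slack: "transport top_eigenvalue \<le> \<epsilon>\<^sup>2"
  shows "\<exists>Q\<in>ambiguity_set \<epsilon> K \<xi>. dual top_eigenvalue \<le> (\<integral>\<zeta>. cost \<zeta> \<partial>Q)"
proof -
  let ?M = top_eigenvalue
  obtain m where m: "d m = ?M" by (rule top_eigenvalue_attained)
  define r where "r = sqrt (\<epsilon>\<^sup>2 - transport ?M)"
  have r: "r\<^sup>2 = \<epsilon>\<^sup>2 - transport ?M"
    using slack by (simp add: r_def)
  have zero: "half_grad (\<xi> k) j = 0" if "d j = ?M" "k \<in> {1..K}" for k j
    using vanish[OF that(1)] that(2) K_pos
    by (auto simp: mean_sq_grad_def sum_nonneg_eq_0_iff)
  define w :: "nat \<Rightarrow> real^'m"
    where "w k = (\<chi> j. half_grad (\<xi> k) j / (?M - d j) + (if j = m then r else 0))" for k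
  \<comment> \<open>There is no cross term: at \<open>j = m\<close> the quotient has denominator 0
    and hence value 0, which leaves \<open>r\<close> alone.\<close>
  have w_sq: "(\<Sum>j\<in>UNIV. (w k $ j)\<^sup>2) = (\<Sum>j\<in>UNIV. (half_grad (\<xi> k) j / (?M - d j))\<^sup>2) + r\<^sup>2" for k
  proof -
    have "(\<Sum>j\<in>UNIV. (w k $ j)\<^sup>2)
        = (\<Sum>j\<in>UNIV. (half_grad (\<xi> k) j / (?M - d j))\<^sup>2 + (if j = m then r\<^sup>2 else 0))"
      by (intro sum.cong refl) (auto simp: w_def m)
    then show ?thesis
      by (simp add: sum.distrib)
  qed
  show ?thesis
  proof (rule dual_le_if_stationary)
    show "(?M - d j) * w k $ j = half_grad (\<xi> k) j" if "k \<in> {1..K}" for k j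
      using zero[OF _ that, of j] by (auto simp: w_def m distrib_left)
    have "(\<Sum>k=1..K. \<Sum>j\<in>UNIV. (w k $ j)\<^sup>2) / real K = transport ?M + r\<^sup>2"
      using K_pos unfolding w_sq by (simp add: transport_eq sum.distrib add_divide_distrib)
    then show "(\<Sum>k=1..K. \<Sum>j\<in>UNIV. (w k $ j)\<^sup>2) / real K = \<epsilon>\<^sup>2"
      by (simp add: r)
  qed
qed

section \<open>Limits in the multiplier\<close>

text \<open>A term with \<open>d j = a\<close> has numerator 0, so it is identically 0 and no pole
  is left at \<open>a\<close>.\<close>

lemma tendsto_dual:
  assumes "\<And>j. d j = a \<Longrightarrow> mean_sq_grad j = 0"
  shows "(dual \<longlongrightarrow> dual a) (at a within S)"
proof -
  have "((\<lambda>l. mean_sq_grad j / (l - d j)) \<longlongrightarrow> mean_sq_grad j / (a - d j)) (at a within S)" for j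
    using assms[of j] by (cases "d j = a") (auto intro!: tendsto_intros)
  then show ?thesis
    unfolding dual_def[abs_def] by (intro tendsto_add tendsto_sum tendsto_mult tendsto_ident_at tendsto_const)
qed

text \<open>Serves for the right limit at the top eigenvalue and, with the hypothesis vacuous, for
  continuity above it.\<close>

lemma tendsto_transport:
  assumes "\<And>j. d j = a \<Longrightarrow> mean_sq_grad j = 0"
  shows "(transport \<longlongrightarrow> transport a) (at a within S)"
proof -
  have "((\<lambda>l. mean_sq_grad j / (l - d j)\<^sup>2) \<longlongrightarrow> mean_sq_grad j / (a - d j)\<^sup>2) (at a within S)" for j
    using assms[of j] by (cases "d j = a") (auto intro!: tendsto_intros)
  then show ?thesis
    unfolding transport_def[abs_def] by (intro tendsto_sum)
qed

lemma tendsto_divide_shift_at_top: "((\<lambda>l. c / (l - a)) \<longlongrightarrow> 0) at_top" for c a :: real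
  by real_asymp

lemma transport_at_top: "(transport \<longlongrightarrow> 0) at_top"
proof -
  have "((\<lambda>l. c / (l - a)\<^sup>2) \<longlongrightarrow> 0) at_top" for c a :: real
    by real_asymp
  then show ?thesis
    unfolding transport_def[abs_def] by (intro tendsto_null_sum)
qed

text \<open>Allows comparison with limits of the dual at the ends of the open range of multipliers,
  at the top eigenvalue and at infinity.\<close>

lemma INF_dual_le:
  assumes "(dual \<longlongrightarrow> c) F" "F \<noteq> bot" "\<forall>\<^sub>F l in F. top_eigenvalue < l"
  shows "(INF l\<in>{top_eigenvalue<..}. ereal (dual l)) \<le> ereal c"
proof (rule tendsto_lowerbound[OF _ _ assms(2)])
  show "((\<lambda>l. ereal (dual l)) \<longlongrightarrow> ereal c) F"
    using assms(1) by (rule tendsto_ereal)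
  show "\<forall>\<^sub>F l in F. (INF l\<in>{top_eigenvalue<..}. ereal (dual l)) \<le> ereal (dual l)"
    using assms(3) by eventually_elim (auto intro: INF_lower)
qed

section \<open>Strong duality\<close>

lemma INF_dual_attained:
  "\<exists>Q\<in>ambiguity_set \<epsilon> K \<xi>.
    (INF l\<in>{top_eigenvalue<..}. ereal (dual l)) \<le> ereal (\<integral>\<zeta>. cost \<zeta> \<partial>Q)"
proof -
  let ?M = top_eigenvalue
  \<comment> \<open>If \<open>slack\<close> fails, some \<open>l\<close> has too large a transport
    cost. Radius 0 is set apart because \<open>transport\<close> tends to 0 but need not reach
    it.\<close>
  consider (slack) "\<forall>l>?M. transport l \<le> \<epsilon>\<^sup>2"
    | (rigid) "\<epsilon> = 0"
    | (tight) l where "?M < l" "\<epsilon>\<^sup>2 < transport l" "0 < \<epsilon>"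
    using \<epsilon>_nonneg by force
  then show ?thesis
  proof cases
    case slack
    have ev: "\<forall>\<^sub>F l in at_right ?M. ?M < l"
      by (rule eventually_at_right_less)
    \<comment> \<open>A single summand of \<open>transport l\<close> is at most
      \<open>\<epsilon>^2\<close>, so its numerator is at most
      \<open>\<epsilon>^2 * (l - ?M)^2\<close>, which tends to 0.\<close>
    have vanish: "mean_sq_grad j = 0" if "d j = ?M" for j
    proof -
      have "((\<lambda>l. \<epsilon>\<^sup>2 * (l - ?M)\<^sup>2) \<longlongrightarrow> \<epsilon>\<^sup>2 * (?M - ?M)\<^sup>2) (at_right ?M)"
        by (intro tendsto_intros)
      moreover have "\<forall>\<^sub>F l in at_right ?M. mean_sq_grad j \<le> \<epsilon>\<^sup>2 * (l - ?M)\<^sup>2"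
        using ev
      proof eventually_elim
        case (elim l)
        have "mean_sq_grad j / (l - ?M)\<^sup>2 \<le> transport l"
          unfolding transport_def that[symmetric]
          by (rule member_le_sum) (auto simp: mean_sq_grad_nonneg)
        with slack elim have "mean_sq_grad j / (l - ?M)\<^sup>2 \<le> \<epsilon>\<^sup>2"
          by (meson order_trans)
        with elim show ?case
          by (simp add: pos_divide_le_eq)
      qed
      ultimately have "mean_sq_grad j \<le> \<epsilon>\<^sup>2 * (?M - ?M)\<^sup>2"
        by (rule tendsto_lowerbound) simp
      with mean_sq_grad_nonneg[of j] show ?thesis by simp
    qed
    have "transport ?M \<le> \<epsilon>\<^sup>2"
    proof (rule tendsto_upperbound[OF tendsto_transport[OF vanish]])
      show "\<forall>\<^sub>F l in at_right ?M. transport l \<le> \<epsilon>\<^sup>2"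
        using ev by eventually_elim (simp add: slack)
    qed simp_all
    from dual_top_le[OF vanish this] obtain Q
      where "Q \<in> ambiguity_set \<epsilon> K \<xi>" "dual ?M \<le> (\<integral>\<zeta>. cost \<zeta> \<partial>Q)"
      by blast
    moreover have "(INF l\<in>{?M<..}. ereal (dual l)) \<le> ereal (dual ?M)"
      by (rule INF_dual_le[OF tendsto_dual[OF vanish] _ ev]) simp_all
    ultimately show ?thesis
      by (meson ereal_less_eq(3) order_trans)
  next
    case rigid
    have "(dual \<longlongrightarrow> 0 + (\<Sum>k=1..K. cost (\<xi> k)) / real K + 0) at_top"
      unfolding dual_def[abs_def] using rigid
      by (intro tendsto_add tendsto_const tendsto_null_sum tendsto_divide_shift_at_top) simp_all
    from INF_dual_le[OF this] have "(INF l\<in>{?M<..}. ereal (dual l)) \<le> ereal (\<integral>\<zeta>. cost \<zeta> \<partial>empirical K \<xi>)"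
      by (simp add: integral_empirical eventually_gt_at_top)
    moreover have "empirical K \<xi> \<in> ambiguity_set \<epsilon> K \<xi>"
      by (intro empirical_in_ambiguity_set K_pos \<epsilon>_nonneg) simp
    ultimately show ?thesis by blast
  next
    case tight
    \<comment> \<open>Decay at infinity provides the right end of the interval for the intermediate
      value theorem; \<open>l\<close> is the left end.\<close>
    have "\<forall>\<^sub>F l' in at_top. transport l' < \<epsilon>\<^sup>2"
      using tight(3) by (intro order_tendstoD(2)[OF transport_at_top]) simp
    then obtain l' where l': "transport l' \<le> \<epsilon>\<^sup>2" "l \<le> l'"
      by (metis (mono_tags, lifting) eventually_at_top_linorder less_imp_le linear order_refl)
    have "continuous_on {l..l'} transport"
      unfolding continuous_on_def
    proof
      fix a assume "a \<in> {l..l'}"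
      then have "d j < a" for j
        using le_top_eigenvalue[of j] tight(1) by simp
      then show "(transport \<longlongrightarrow> transport a) (at a within {l..l'})"
        by (intro tendsto_transport) (simp add: less_imp_neq)
    qed
    then obtain a where "l \<le> a" "transport a = \<epsilon>\<^sup>2"
      using IVT2'[of transport l' "\<epsilon>\<^sup>2" l] l' tight(2) by auto
    with tight(1) have a: "?M < a" "transport a = \<epsilon>\<^sup>2"
      by auto
    from dual_le_if_transport_eq[OF this] obtain Q
      where "Q \<in> ambiguity_set \<epsilon> K \<xi>" "dual a \<le> (\<integral>\<zeta>. cost \<zeta> \<partial>Q)"
      by blast
    moreover have "(INF l\<in>{?M<..}. ereal (dual l)) \<le> ereal (dual a)"
      using a(1) by (intro INF_lower) simp
    ultimately show ?thesis
      by (meson ereal_less_eq(3) order_trans)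
  qed
qed

text \<open>The constant \<open>c\<close> makes room for \<open>f i x\<close>, which does not depend
  on the distribution.\<close>

theorem strong_duality:
  "(SUP Q\<in>ambiguity_set \<epsilon> K \<xi>. ereal (c + (\<integral>\<zeta>. cost \<zeta> \<partial>Q)))
    = (INF l\<in>{top_eigenvalue<..}. ereal (c + dual l))"
proof (rule antisym)
  show "(SUP Q\<in>ambiguity_set \<epsilon> K \<xi>. ereal (c + (\<integral>\<zeta>. cost \<zeta> \<partial>Q)))
      \<le> (INF l\<in>{top_eigenvalue<..}. ereal (c + dual l))"
    by (intro SUP_least INF_greatest) (simp add: weak_duality)
  let ?I = "INF l\<in>{top_eigenvalue<..}. ereal (c + dual l)"
  obtain Q where Q: "Q \<in> ambiguity_set \<epsilon> K \<xi>"
    "(INF l\<in>{top_eigenvalue<..}. ereal (dual l)) \<le> ereal (\<integral>\<zeta>. cost \<zeta> \<partial>Q)"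
    using INF_dual_attained by blast
  \<comment> \<open>Moves \<open>c\<close> out of the infimum; since \<open>?I\<close> is an
    extended real, its infinite values are treated by cases.\<close>
  have "?I - ereal c \<le> ereal (dual l)" if "top_eigenvalue < l" for l
  proof -
    have "?I \<le> ereal (c + dual l)"
      using that by (intro INF_lower) simp
    then show ?thesis
      by (cases ?I) auto
  qed
  then have "?I - ereal c \<le> (INF l\<in>{top_eigenvalue<..}. ereal (dual l))"
    by (intro INF_greatest) simp
  also note Q(2)
  finally have "?I \<le> ereal (c + (\<integral>\<zeta>. cost \<zeta> \<partial>Q))"
    by (cases ?I) auto
  also have "\<dots> \<le> (SUP Q\<in>ambiguity_set \<epsilon> K \<xi>. ereal (c + (\<integral>\<zeta>. cost \<zeta> \<partial>Q)))"
    using Q(1) by (rule SUP_upper)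
  finally show "?I \<le> (SUP Q\<in>ambiguity_set \<epsilon> K \<xi>. ereal (c + (\<integral>\<zeta>. cost \<zeta> \<partial>Q)))" .
qed

section \<open>The dual in the form of the reformulated objective\<close>

lemma dual_eq_reformulated:
  assumes "top_eigenvalue < l"
  shows "dual l = l * (\<epsilon>\<^sup>2 - 1 / real K * (\<Sum>k=1..K. \<xi> k \<bullet> \<xi> k))
    + 1 / (4 * real K) * (\<Sum>k=1..K. \<Sum>j\<in>UNIV. (q $ j + 2 * l * (L *v \<xi> k) $ j)\<^sup>2 / (l - d j))"
proof -
  \<comment> \<open>Since \<open>p + 2 * l * u = 2 * (c + (l - a) * u)\<close>, expanding the square
    on the right gives \<open>c^2 / (l - a) + 2 * c * u + (l - a) * u^2\<close>.\<close>
  have coord: "a * u\<^sup>2 + p * u + (p / 2 + a * u)\<^sup>2 / (l - a) = (p + 2 * l * u)\<^sup>2 / (l - a) / 4 - l * u\<^sup>2"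
    if "a < l" for a p u :: real
  proof -
    define c where "c = p / 2 + a * u"
    have p: "p = 2 * (c - a * u)"
      by (simp add: c_def)
    show ?thesis
      unfolding c_def[symmetric] unfolding p using that by (simp add: field_simps power2_eq_square)
  qed
  have "cost \<zeta> + (\<Sum>j\<in>UNIV. (half_grad \<zeta> j)\<^sup>2 / (l - d j))
      = (\<Sum>j\<in>UNIV. (q $ j + 2 * l * (L *v \<zeta>) $ j)\<^sup>2 / (l - d j)) / 4 - l * (\<zeta> \<bullet> \<zeta>)" for \<zeta>
  proof -
    have "\<zeta> \<bullet> \<zeta> = (\<Sum>j\<in>UNIV. ((L *v \<zeta>) $ j)\<^sup>2)"
      using norm_diff_sq[of \<zeta> 0] by (simp add: power2_norm_eq_inner)
    then show ?thesis
      unfolding cost_def half_grad_def sum.distrib[symmetric] sum_divide_distrib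
      by (simp only: sum_distrib_left sum_subtractf[symmetric])
        (intro sum.cong refl coord le_less_trans[OF le_top_eigenvalue assms])
  qed
  then show ?thesis
    unfolding dual_eq
    by (simp add: sum_subtractf diff_divide_distrib right_diff_distrib flip: sum_divide_distrib sum_distrib_left)
qed

end

section \<open>The reformulated game\<close>

lemma orthogonal_matrix_cancel:
  assumes "orthogonal_matrix L"
  shows "transpose L *v (L *v v) = v" "L *v (transpose L *v v) = v"
  using assms by (simp_all only: matrix_vector_mul_assoc orthogonal_matrix_def matrix_vector_mul_lid)

lemma inner_matrix_mult_left: "(M *v v) \<bullet> w = v \<bullet> (transpose M *v w)" for M :: "real^'n^'m"
  by (metis dot_lmul_matrix inner_commute transpose_matrix_vector)

text \<open>\<open>L\<close> carries eigenvectors of the conjugate to those of \<open>D\<close>, and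
  its transpose carries them back.\<close>

lemma eigenvals_orthogonal_conjugate:
  assumes "orthogonal_matrix L"
  shows "eigenvals (transpose L ** D ** L) = eigenvals D"
proof -
  note c = orthogonal_matrix_cancel[OF assms]
  have mult: "(transpose L ** D ** L) *v v = transpose L *v (D *v (L *v v))" for v
    by (simp only: matrix_vector_mul_assoc matrix_mul_assoc)
  show ?thesis
  proof (intro subset_antisym subsetI)
    fix e assume "e \<in> eigenvals (transpose L ** D ** L)"
    then obtain v where v: "v \<noteq> 0" "transpose L *v (D *v (L *v v)) = e *\<^sub>R v"
      unfolding eigenvals_def mult by blast
    have "D *v (L *v v) = L *v (e *\<^sub>R v)"
      unfolding v(2)[symmetric] c ..
    then have "D *v (L *v v) = e *\<^sub>R (L *v v)"
      by (simp only: matrix_vector_mult_scaleR)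
    moreover have "L *v v \<noteq> 0"
      using v(1) c(1)[of v] by (metis matrix_vector_mult_0_right)
    ultimately show "e \<in> eigenvals D"
      unfolding eigenvals_def by blast
  next
    fix e assume "e \<in> eigenvals D"
    then obtain v where v: "v \<noteq> 0" "D *v v = e *\<^sub>R v"
      unfolding eigenvals_def by blast
    have "(transpose L ** D ** L) *v (transpose L *v v) = e *\<^sub>R (transpose L *v v)"
      unfolding mult c v(2) by (simp only: matrix_vector_mult_scaleR)
    moreover have "transpose L *v v \<noteq> 0"
      using v(1) c(2)[of v] by (metis matrix_vector_mult_0_right)
    ultimately show "e \<in> eigenvals (transpose L ** D ** L)"
      unfolding eigenvals_def by blast
  qed
qed

text \<open>Settles the distributional part one profile at a time, with \<open>d\<close> the
  diagonal of \<open>D i\<close> and \<open>q\<close> the rotated linear coefficient.\<close>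

lemma worst_case_eq_INF_objective_GR:
  fixes P :: "'i \<Rightarrow> (real^'n)^'i \<Rightarrow> real^'m"
  assumes "0 \<le> \<epsilon> i" "1 \<le> K i"
    and g: "\<And>\<zeta>. g i x \<zeta> = \<zeta> \<bullet> (Q i *v \<zeta>) + P i x \<bullet> \<zeta>"
    and Q: "Q i = transpose (L i) ** D i ** L i"
    and L: "orthogonal_matrix (L i)"
    and D: "is_diagonal (D i)" "positive_semidefinite (D i)"
  shows "worst_case f g \<epsilon> K \<xi> i x
    = (INF l\<in>{lambda_max (Q i)<..}. ereal (objective_GR f P L D \<epsilon> K \<xi> i x l))"
proof -
  define d where "d j = D i $ j $ j" for j
  define q where "q = L i *v P i x"
  have D_mult: "(D i *v v) $ j = d j * v $ j" for v j
    using D(1) by (simp add: d_def diagonal_mult_vec)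
  have "0 \<le> d j" for j
  proof -
    have "0 \<le> axis j 1 \<bullet> (D i *v axis j 1)"
      using D(2) by (simp add: positive_semidefinite_def)
    then show ?thesis
      by (simp add: inner_axis' D_mult)
  qed
  then interpret diagonalised_dro "L i" d q "\<epsilon> i" "K i" "\<xi> i"
    by unfold_locales (use assms in auto)
  have "g i x \<zeta> = cost \<zeta>" for \<zeta>
  proof -
    have "\<zeta> \<bullet> (Q i *v \<zeta>) = (L i *v \<zeta>) \<bullet> (D i *v (L i *v \<zeta>))"
      unfolding Q by (simp only: inner_matrix_mult_left flip: matrix_vector_mul_assoc)
    moreover have "P i x \<bullet> \<zeta> = q \<bullet> (L i *v \<zeta>)"
      unfolding q_def inner_matrix_mult_left orthogonal_matrix_cancel[OF L] ..
    ultimately show ?thesis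
      unfolding g cost_def
      by (simp add: inner_vec_def D_mult sum.distrib power2_eq_square mult_ac)
  qed
  then have "worst_case f g \<epsilon> K \<xi> i x
      = (SUP R\<in>ambiguity_set (\<epsilon> i) (K i) (\<xi> i). ereal (f i x + (\<integral>\<zeta>. cost \<zeta> \<partial>R)))"
    by (simp add: worst_case_def)
  also have "\<dots> = (INF l\<in>{top_eigenvalue<..}. ereal (f i x + dual l))"
    by (rule strong_duality)
  also have "top_eigenvalue = lambda_max (D i)"
    by (simp add: top_eigenvalue_def lambda_max_def eigenvals_diagonal[OF D(1)] d_def)
  also have "(INF l\<in>{lambda_max (D i)<..}. ereal (f i x + dual l))
      = (INF l\<in>{lambda_max (D i)<..}. ereal (objective_GR f P L D \<epsilon> K \<xi> i x l))"
  proof (intro INF_cong refl)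
    fix l assume "l \<in> {lambda_max (D i)<..}"
    then have l: "lambda_max (D i) < l" by simp
    have diag: "is_diagonal (Q_tilde (D i) l)" "Q_tilde (D i) l $ j $ j = 1 / (l - d j)" for j
      unfolding Q_tilde_diagonal[OF D(1) l] by (simp_all add: is_diagonal_def d_def)
    have "W \<bullet> (Q_tilde (D i) l *v W) = (\<Sum>j\<in>UNIV. (W $ j)\<^sup>2 / (l - d j))" for W
      by (simp add: inner_vec_def diagonal_mult_vec[OF diag(1)] diag(2) power2_eq_square)
    then show "ereal (f i x + dual l) = ereal (objective_GR f P L D \<epsilon> K \<xi> i x l)"
      unfolding dual_eq_reformulated[OF l[folded \<open>top_eigenvalue = lambda_max (D i)\<close>]]
      by (simp add: objective_GR_def W_tilde_def P_tilde_def xi_tilde_def q_def)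
  qed
  also have "lambda_max (D i) = lambda_max (Q i)"
    unfolding Q lambda_max_def eigenvals_orthogonal_conjugate[OF L] ..
  finally show ?thesis .
qed

theorem theorem1:
  fixes X :: "'i::finite \<Rightarrow> (real^'n) set"
    and f :: "'i \<Rightarrow> (real^'n)^'i \<Rightarrow> real"
    and g :: "'i \<Rightarrow> (real^'n)^'i \<Rightarrow> real^('m::{finite,linorder}) \<Rightarrow> real"
    and P :: "'i \<Rightarrow> (real^'n)^'i \<Rightarrow> real^('m::{finite,linorder})"
    and A :: "'i \<Rightarrow> real^('i \<times> 'n)^('m::{finite,linorder})"
    and b :: "'i \<Rightarrow> real^('m::{finite,linorder})"
    and Q L D :: "'i \<Rightarrow> real^('m::{finite,linorder})^('m::{finite,linorder})"
    and \<epsilon> :: "'i \<Rightarrow> real"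
    and K :: "'i \<Rightarrow> nat"
    and \<xi> :: "'i \<Rightarrow> nat \<Rightarrow> real^('m::{finite,linorder})"
  assumes radius: "\<And>i. 0 \<le> \<epsilon> i"
    and samples: "\<And>i. 1 \<le> K i"
    and f_convex: "\<And>i x. x \<in> opponents X i \<Longrightarrow> convex_on UNIV (\<lambda>y. f i (with_decision x i y))"
    and g_quadratic: "\<And>i x \<zeta>. g i x \<zeta> = \<zeta> \<bullet> (Q i *v \<zeta>) + P i x \<bullet> \<zeta>"
    and P_affine: "\<And>i x. P i x = A i *v stacked x + b i"
    and Q_decomp: "\<And>i. Q i = transpose (L i) ** D i ** L i"
    and L_orthogonal: "\<And>i. orthogonal_matrix (L i)"
    and D_diagonal: "\<And>i. is_diagonal (D i)"
    and D_psd: "\<And>i. positive_semidefinite (D i)"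
    and D_sorted: "\<And>i. decreasing_diagonal (D i)"
  shows "(\<forall>i. \<forall>x\<in>opponents X i.
            optimal_value_G X f g \<epsilon> K \<xi> i x = optimal_value_GR X f P Q L D \<epsilon> K \<xi> i x) \<and>
         (\<forall>x lam. nash_equilibrium_GR X f P Q L D \<epsilon> K \<xi> x lam \<longrightarrow>
            dr_nash_equilibrium X f g \<epsilon> K \<xi> x)"
proof -
  have worst: "worst_case f g \<epsilon> K \<xi> i x
      = (INF l\<in>{lambda_max (Q i)<..}. ereal (objective_GR f P L D \<epsilon> K \<xi> i x l))" for i x
    by (intro worst_case_eq_INF_objective_GR radius samples g_quadratic Q_decomp L_orthogonal
        D_diagonal D_psd)
  show ?thesis
  proof (intro conjI allI ballI impI)
    fix i x
    show "optimal_value_G X f g \<epsilon> K \<xi> i x = optimal_value_GR X f P Q L D \<epsilon> K \<xi> i x"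
      \<comment> \<open>What remains is that an iterated infimum equals the infimum over the
        product.\<close>
      unfolding optimal_value_G_def optimal_value_GR_def worst
      by (rule antisym) (auto intro!: INF_greatest intro: INF_lower2 INF_lower)
  next
    fix x lam assume "nash_equilibrium_GR X f P Q L D \<epsilon> K \<xi> x lam"
    then have mem: "x $ i \<in> X i" "lambda_max (Q i) < lam i"
      and opt: "\<And>y l. y \<in> X i \<Longrightarrow> lambda_max (Q i) < l \<Longrightarrow>
        objective_GR f P L D \<epsilon> K \<xi> i (with_decision x i (x $ i)) (lam i)
          \<le> objective_GR f P L D \<epsilon> K \<xi> i (with_decision x i y) l" for i
      unfolding nash_equilibrium_GR_def is_arg_min_linorder by auto
    \<comment> \<open>The worst case at \<open>x $ i\<close> is at most the objective at
      \<open>lam i\<close>, which is at most the objective at every \<open>(y, l)\<close>; then the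
      infimum over \<open>l\<close> is taken.\<close>
    have "worst_case f g \<epsilon> K \<xi> i (with_decision x i (x $ i)) \<le> worst_case f g \<epsilon> K \<xi> i (with_decision x i y)"
      if "y \<in> X i" for i y
      unfolding worst using mem(2) opt[OF that]
      by (intro INF_greatest INF_lower2[of "lam i"]) auto
    with mem(1) show "dr_nash_equilibrium X f g \<epsilon> K \<xi> x"
      unfolding dr_nash_equilibrium_def is_arg_min_linorder by blast
  qed
qed

end
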